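(* Let $d_0$ be the distance from $x_0$ to $S_*$, and let $x_*$ be the projection of $x_0$ onto $S_*$. Let $(x_k,\tilde x_k,\tau_k,y_k)$ be the sequence generated by IE-FISTA. Then, for all $k\in\mathbb{N}$, $$\frac{1}{2}\|x_{k}-x_*\|^2+\tau_k(F(\tilde x_{k})-F^* )+\frac{1-\sigma^2}{2\alpha}\sum_{i=1}^{k}\tau_{i}\|\tilde x_{i}-y_{i-1}\|^2\leq\frac{1}{2}d_0^2.$$ In particular, for all $k\in\mathbb{N}$, $$F(\tilde x_{k})-F^*\leq\frac{2(1+\alpha L)}{\alpha k^2}d_0^2.$$
   Context: $\mathbb{N}=\{1,2,\dots\}$. $\mathbb{E}$ is a finite-dimensional real vector space with inner product $\langle\cdot,\cdot\rangle$ and induced norm $\|\cdot\|$. $f\colon\mathbb{E}\to\mathbb{R}$ is a differentiable convex function whose gradient is $L$-Lipschitz continuous, $L>0$; $g\colon\mathbb{E}\to\mathbb{R}\cup\{+\infty\}$ is a proper lower semicontinuous convex function; $F:=f+g$. $F^*:=\inf_{x\in\mathbb{E}}F(x)$ is assumed to be finite, and the set of minimizers $S_*$ of $F$ is assumed nonempty. For $\varepsilon\ge 0$ and $x\in\mathbb{E}$ (with $g(x)<+\infty$), $\partial_\varepsilon g(x):=\{u\in\mathbb{E}\mid g(y)\ge g(x)+\langle u,y-x\rangle-\varepsilon\ \ \forall y\in\mathbb{E}\}$ (empty if $g(x)=+\infty$). IE-FISTA: let $x_0\in\mathbb{E}$, $\alpha>1/L$ and $\sigma\in[0,1]$ be given;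 set $\lambda:=\alpha/(1+\alpha L)$, $\tau_0:=0$, $\tilde x_0:=x_0$. For $k=0,1,2,\dots$ compute $$\tau_{k+1}:=\tau_k+\frac{\lambda+\sqrt{\lambda^2+4\lambda\tau_k}}{2},\qquad y_k:=\frac{\tau_k}{\tau_{k+1}}\tilde x_k+\frac{\tau_{k+1}-\tau_k}{\tau_{k+1}}x_k,$$ find any triple $(\tilde x_{k+1},v_{k+1},\varepsilon_{k+1})\in\mathbb{E}\times\mathbb{E}\times[0,+\infty)$ such that $$v_{k+1}\in\partial_{\varepsilon_{k+1}}g(\tilde x_{k+1})+L(\tilde x_{k+1}-y_k)+\nabla f(y_k),\qquad \|\alpha v_{k+1}+\tilde x_{k+1}-y_k\|^2+2\alpha\varepsilon_{k+1}\le\sigma^2\|\tilde x_{k+1}-y_k\|^2,$$ and set $$x_{k+1}:=x_k-(\tau_{k+1}-\tau_k)\big(v_{k+1}+L(y_k-\tilde x_{k+1})\big).$$ *)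

theory Defs
  imports "HOL-Analysis.Analysis"
begin

text \<open>Finite-dimensional real inner product spaces are rendered by the sort
  \<open>{real_inner, heine_borel}\<close>, as in the library's \<^const>\<open>closest_point\<close>: a real normed space is
  finite-dimensional iff its closed bounded sets are compact. Unlike \<^class>\<open>euclidean_space\<close>,
  this does not exclude the zero space.\<close>

definition proper_fun :: "('a \<Rightarrow> ereal) \<Rightarrow> bool" where
  "proper_fun g \<longleftrightarrow> (\<forall>x. g x \<noteq> -\<infinity>) \<and> (\<exists>x. g x \<noteq> \<infinity>)"

definition lower_semicontinuous :: "('a::topological_space \<Rightarrow> ereal) \<Rightarrow> bool" where
  "lower_semicontinuous g \<longleftrightarrow> (\<forall>x. g x \<le> Liminf (at x) g)"

text \<open>The extended-valued counterpart of \<^const>\<open>convex_on\<close> on the whole space. It is meant for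
  functions that never take the value \<open>-\<infinity>\<close>; on \<^typ>\<open>ereal\<close> the convention \<open>0 * \<infinity> = 0\<close> makes the
  cases \<open>u = 0\<close> and \<open>v = 0\<close> trivial.\<close>

definition ereal_convex :: "('a::real_vector \<Rightarrow> ereal) \<Rightarrow> bool" where
  "ereal_convex g \<longleftrightarrow> (\<forall>x y. \<forall>u\<ge>0. \<forall>v\<ge>0. u + v = 1 \<longrightarrow>
     g (u *\<^sub>R x + v *\<^sub>R y) \<le> ereal u * g x + ereal v * g y)"

definition eps_subdiff :: "real \<Rightarrow> ('a::real_inner \<Rightarrow> ereal) \<Rightarrow> 'a \<Rightarrow> 'a set" where
  "eps_subdiff \<epsilon> g x =
     {u. g x < \<infinity> \<and> (\<forall>y. g y \<ge> g x + ereal (u \<bullet> (y - x)) - ereal \<epsilon>)}"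

definition minimizers :: "('a \<Rightarrow> ereal) \<Rightarrow> 'a set" where
  "minimizers F = {x. \<forall>y. F x \<le> F y}"

text \<open>\<open>ie_fista gradf g L \<alpha> \<sigma> x0 x xt \<tau> y v \<epsilon>\<close> says that the given sequences are a run of
  IE-FISTA for the data \<open>gradf\<close> (the gradient of the smooth part), \<open>g\<close>, \<open>L\<close>, \<open>\<alpha>\<close>, \<open>\<sigma>\<close>
  and the starting point \<open>x0\<close>; \<open>xt\<close> stands for the sequence written with a tilde. The algorithm
  only requires some admissible triple at each step, so this is a relation, not a function.
  The values \<open>v 0\<close> and \<open>\<epsilon> 0\<close> are not used.\<close>

definition ie_fista ::
  "('a::real_inner \<Rightarrow> 'a) \<Rightarrow> ('a \<Rightarrow> ereal) \<Rightarrow> real \<Rightarrow> real \<Rightarrow> real \<Rightarrow> 'a \<Rightarrow>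
   (nat \<Rightarrow> 'a) \<Rightarrow> (nat \<Rightarrow> 'a) \<Rightarrow> (nat \<Rightarrow> real) \<Rightarrow> (nat \<Rightarrow> 'a) \<Rightarrow> (nat \<Rightarrow> 'a) \<Rightarrow> (nat \<Rightarrow> real) \<Rightarrow> bool"
where
  "ie_fista gradf g L \<alpha> \<sigma> x0 x xt \<tau> y v \<epsilon> \<longleftrightarrow>
     (let lam = \<alpha> / (1 + \<alpha> * L) in
       x 0 = x0 \<and> xt 0 = x0 \<and> \<tau> 0 = 0 \<and>
       (\<forall>k.
          \<tau> (Suc k) = \<tau> k + (lam + sqrt (lam\<^sup>2 + 4 * lam * \<tau> k)) / 2 \<and>
          y k = (\<tau> k / \<tau> (Suc k)) *\<^sub>R xt k + ((\<tau> (Suc k) - \<tau> k) / \<tau> (Suc k)) *\<^sub>R x k \<and>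
          \<epsilon> (Suc k) \<ge> 0 \<and>
          v (Suc k) \<in> (\<lambda>u. u + L *\<^sub>R (xt (Suc k) - y k) + gradf (y k)) `
                        eps_subdiff (\<epsilon> (Suc k)) g (xt (Suc k)) \<and>
          (norm (\<alpha> *\<^sub>R v (Suc k) + xt (Suc k) - y k))\<^sup>2 + 2 * \<alpha> * \<epsilon> (Suc k)
            \<le> \<sigma>\<^sup>2 * (norm (xt (Suc k) - y k))\<^sup>2 \<and>
          x (Suc k) = x k - (\<tau> (Suc k) - \<tau> k) *\<^sub>R (v (Suc k) + L *\<^sub>R (y k - xt (Suc k)))))"

end

theory Submission
  imports Defs
begin

text \<open>Fix a step of the method, write \<open>r = xt (Suc k) - y k\<close> for its displacement and
  \<open>w = v (Suc k) - L r\<close>, so that \<open>w\<close> is an \<open>\<epsilon>\<close>-subgradient of \<open>g\<close> at the new point plus the gradient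
  of \<open>f\<close> at \<open>y k\<close>. Linearising \<open>f\<close> at \<open>y k\<close> from below by convexity and from above by the descent
  lemma gives, for every \<open>z\<close>,
  \<open>F z \<ge> F (xt (Suc k)) + w \<bullet> (z - xt (Suc k)) - \<epsilon> - L/2 \<parallel>r\<parallel>\<^sup>2\<close> (\<open>composite_lower_bound\<close>).

  Using this bound at \<open>xt k\<close> with weight \<open>\<tau> k\<close> and at the minimizer with weight
  \<open>a = \<tau> (Suc k) - \<tau> k\<close>, the definition of \<open>y k\<close> as the corresponding average makes the scalar products
  combine into \<open>a (w \<bullet> (xstar - x k))\<close>, which is the cross term of the expansion of
  \<open>\<parallel>x k - a w - xstar\<parallel>\<^sup>2\<close>, and \<open>- \<tau> (Suc k) (w \<bullet> r)\<close>. The step sizes satisfy \<open>a\<^sup>2 = \<lambda> \<tau> (Suc k)\<close>, so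
  every error term carries the factor \<open>\<tau> (Suc k)\<close>; the relative error criterion is what makes
  their sum at most \<open>- (1 - \<sigma>\<^sup>2) / (2 \<alpha>) \<parallel>r\<parallel>\<^sup>2\<close> (\<open>relative_error_residual\<close>). Hence the potential
  \<open>1/2 \<parallel>x k - xstar\<parallel>\<^sup>2 + \<tau> k (F (xt k) - F xstar)\<close> drops by at least the
  summand of the claimed estimate (\<open>accelerated_step_decrease\<close>), and the estimate follows by telescoping.

  The rate follows because \<open>\<tau> k\<close> grows at least like \<open>\<lambda> k\<^sup>2 / 4\<close>. Lower semicontinuity makes the
  set of minimizers closed, so that the projection \<open>xstar\<close> is a minimizer at distance \<open>d0\<close> from the
  starting point.\<close>

section \<open>Convex functions with Lipschitz gradient\<close>

lemma GDERIV_imp_DERIV_along_line: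
  fixes f :: "'a::real_inner \<Rightarrow> real"
  assumes "GDERIV f (p + t *\<^sub>R d) :> D"
  shows "((\<lambda>s. f (p + s *\<^sub>R d)) has_real_derivative D \<bullet> d) (at t)"
proof -
  have line: "((\<lambda>s. p + s *\<^sub>R d) has_derivative (\<lambda>h. h *\<^sub>R d)) (at t)"
    by (auto intro!: derivative_eq_intros)
  have "((\<lambda>s. f (p + s *\<^sub>R d)) has_derivative (\<lambda>h. (h *\<^sub>R d) \<bullet> D)) (at t)"
    using has_derivative_compose[OF line] assms unfolding gderiv_def by fastforce
  then show ?thesis
    by (simp add: has_field_derivative_def inner_commute mult.commute[of _ "D \<bullet> d"])
qed

lemma convex_on_imp_above_gradient_tangent:
  fixes f :: "'a::real_inner \<Rightarrow> real"
  assumes "convex_on UNIV f" and "GDERIV f p :> D"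
  shows "f z \<ge> f p + D \<bullet> (z - p)"
proof -
  define d where "d = z - p"
  define \<phi> where "\<phi> t = f (p + t *\<^sub>R d)" for t :: real
  have "convex_on UNIV \<phi>"
  proof (rule convex_onI)
    fix t a b :: real
    assume t: "0 < t" "t < 1"
    have "p + ((1 - t) *\<^sub>R a + t *\<^sub>R b) *\<^sub>R d
        = (1 - t) *\<^sub>R (p + a *\<^sub>R d) + t *\<^sub>R (p + b *\<^sub>R d)"
      by (simp add: algebra_simps)
    then show "\<phi> ((1 - t) *\<^sub>R a + t *\<^sub>R b) \<le> (1 - t) * \<phi> a + t * \<phi> b"
      using convex_onD[OF assms(1), of t "p + a *\<^sub>R d" "p + b *\<^sub>R d"] t
      by (simp add: \<phi>_def)
  qed simp
  moreover have "(\<phi> has_real_derivative D \<bullet> d) (at 0)"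
    using GDERIV_imp_DERIV_along_line[of f p 0 d D] assms(2) unfolding \<phi>_def by simp
  ultimately have "\<phi> 1 - \<phi> 0 \<ge> (D \<bullet> d) * (1 - 0)"
    by (intro convex_on_imp_above_tangent[where A = UNIV]) auto
  then show ?thesis
    by (simp add: \<phi>_def d_def)
qed

text \<open>The descent lemma. Along the segment from \<open>p\<close> to \<open>z\<close>, subtracting the quadratic upper model
  from the function leaves something whose derivative at time \<open>t\<close> is
  \<open>(G (p + t d) - G p) \<bullet> d - L t \<parallel>d\<parallel>\<^sup>2\<close>, which is nonpositive by Cauchy-Schwarz.\<close>

lemma lipschitz_gradient_quadratic_upper_bound:
  fixes f :: "'a::real_inner \<Rightarrow> real"
  assumes grad: "\<And>z. GDERIV f z :> G z" and lip: "L-lipschitz_on UNIV G"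
  shows "f z \<le> f p + G p \<bullet> (z - p) + L / 2 * (norm (z - p))\<^sup>2"
proof -
  define d where "d = z - p"
  define \<psi> where "\<psi> t = f (p + t *\<^sub>R d) - t * (G p \<bullet> d) - L / 2 * (norm d)\<^sup>2 * t\<^sup>2" for t :: real
  have der: "(\<psi> has_real_derivative G (p + t *\<^sub>R d) \<bullet> d - G p \<bullet> d - L * (norm d)\<^sup>2 * t) (at t)" for t
    unfolding \<psi>_def
    by (rule DERIV_cong, (rule derivative_intros GDERIV_imp_DERIV_along_line grad)+) simp
  have nonpos: "G (p + t *\<^sub>R d) \<bullet> d - G p \<bullet> d - L * (norm d)\<^sup>2 * t \<le> 0" if "0 \<le> t" for t
  proof -
    have "(G (p + t *\<^sub>R d) - G p) \<bullet> d \<le> norm (G (p + t *\<^sub>R d) - G p) * norm d"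
      by (rule norm_cauchy_schwarz)
    also have "\<dots> \<le> (L * (t * norm d)) * norm d"
      using lipschitz_onD[OF lip, of "p + t *\<^sub>R d" p] that
      by (intro mult_right_mono) (auto simp: dist_norm)
    finally show ?thesis
      by (simp add: inner_diff_left power2_eq_square algebra_simps)
  qed
  have "\<psi> 1 \<le> \<psi> 0"
  proof (rule DERIV_nonpos_imp_nonincreasing[where a = 0 and b = 1 and f = \<psi>])
    fix t :: real
    assume "0 \<le> t"
    then show "\<exists>m. (\<psi> has_real_derivative m) (at t) \<and> m \<le> 0"
      using der[of t] nonpos[of t] by blast
  qed simp
  then show ?thesis
    by (simp add: \<psi>_def d_def)
qed

section \<open>The projection onto the set of minimizers\<close>

text \<open>The set of minimizers is the intersection over \<open>y\<close> of the sublevel sets at height \<open>f y + g y\<close>, and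
  these are closed because \<open>f + g\<close> is lower semicontinuous: near a point outside, a real threshold
  \<open>c\<close> separates the two summands, and each stays above its share of the level.\<close>

lemma closed_minimizers_add_lower_semicontinuous:
  fixes f :: "'a::topological_space \<Rightarrow> real" and g :: "'a \<Rightarrow> ereal"
  assumes cont: "continuous_on UNIV f" and lsc: "lower_semicontinuous g"
    and not_MInf: "\<And>z. g z \<noteq> -\<infinity>"
  shows "closed (minimizers (\<lambda>z. ereal (f z) + g z))"
proof -
  let ?F = "\<lambda>z. ereal (f z) + g z"
  have "open {z. ?F y < ?F z}" for y
  proof (subst open_subopen, safe)
    fix z assume less: "?F y < ?F z"
    then obtain r where r: "?F y = ereal r"
      using not_MInf[of y] by (cases "g y") auto
    have "ereal (r - f z) < g z"
      using less unfolding r by (cases "g z") auto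
    then obtain c where c: "ereal (r - f z) < ereal c" "ereal c < g z"
      using ereal_dense2 by blast
    have "ereal c < Liminf (at z) g"
      using c(2) lsc unfolding lower_semicontinuous_def by (meson less_le_trans)
    then have "\<forall>\<^sub>F w in at z. ereal c < g w"
      by (rule less_LiminfD)
    then have "\<forall>\<^sub>F w in nhds z. ereal c < g w"
      using c(2) by (auto simp: eventually_at_filter elim: eventually_mono)
    moreover have "(f \<longlongrightarrow> f z) (nhds z)"
      using cont by (simp add: continuous_on_def tendsto_at_iff_tendsto_nhds)
    then have "\<forall>\<^sub>F w in nhds z. r - c < f w"
      using c(1) by (intro order_tendstoD) auto
    ultimately have "\<forall>\<^sub>F w in nhds z. ereal r < ?F w"
    proof eventually_elim
      case (elim w)
      then show ?case by (cases "g w") auto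
    qed
    then show "\<exists>T. open T \<and> z \<in> T \<and> T \<subseteq> {z. ?F y < ?F z}"
      unfolding r by (auto simp: eventually_nhds)
  qed
  then have "closed (\<Inter>y. - {z. ?F y < ?F z})"
    by (intro closed_INT ballI closed_Compl)
  moreover have "minimizers ?F = (\<Inter>y. - {z. ?F y < ?F z})"
    by (simp add: minimizers_def set_eq_iff not_less)
  ultimately show ?thesis
    by simp
qed

lemma dist_closest_point_eq_infdist:
  fixes S :: "'a::{real_inner, heine_borel} set"
  assumes "closed S" and "S \<noteq> {}"
  shows "dist a (closest_point S a) = infdist a S"
proof (rule antisym)
  show "dist a (closest_point S a) \<le> infdist a S"
    using closest_point_exists(2)[OF assms] assms(2)
    by (auto simp: infdist_notempty intro: cINF_greatest)
  show "infdist a S \<le> dist a (closest_point S a)"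
    by (rule infdist_le[OF closest_point_in_set[OF assms]])
qed

section \<open>One accelerated step\<close>

text \<open>An inexact proximal gradient step at \<open>p\<close>, linearised at \<open>q\<close>, yields an affine minorant of
  \<open>f + g\<close> whose slope is the sum of the two slopes. The loss \<open>L / 2 \<parallel>p - q\<parallel>\<^sup>2\<close> at the new point comes
  from comparing \<open>f p\<close> with the linearisation of \<open>f\<close> at \<open>q\<close>.\<close>

lemma composite_lower_bound:
  fixes f :: "'a::real_inner \<Rightarrow> real"
  assumes "convex_on UNIV f" and grad: "\<And>z. GDERIV f z :> G z" and lip: "L-lipschitz_on UNIV G"
    and u: "u \<in> eps_subdiff e g p" and gp: "g p = ereal gp" and gz: "g z = ereal gz"
  shows "f z + gz \<ge> f p + gp + (u + G q) \<bullet> (z - p) - e - L / 2 * (norm (p - q))\<^sup>2"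
proof -
  have "f z \<ge> f q + G q \<bullet> (z - q)"
    by (rule convex_on_imp_above_gradient_tangent[OF assms(1) grad])
  moreover have "f p \<le> f q + G q \<bullet> (p - q) + L / 2 * (norm (p - q))\<^sup>2"
    by (rule lipschitz_gradient_quadratic_upper_bound[OF grad lip])
  moreover have "gz \<ge> gp + u \<bullet> (z - p) - e"
    using u gp gz unfolding eps_subdiff_def by (auto dest!: spec[of _ z])
  ultimately show ?thesis
    by (simp add: inner_add_left inner_diff_right)
qed

text \<open>Let \<open>B = 1 + \<alpha> L\<close> and let \<open>Q = \<parallel>\<alpha> w + B r\<parallel>\<^sup>2\<close> be the squared residual. The criterion bounds
  \<open>2 \<alpha> e\<close> by \<open>\<sigma>\<^sup>2 \<parallel>r\<parallel>\<^sup>2 - Q\<close>. With \<open>\<lambda> = \<alpha> / B\<close>, the other terms of the left-hand side, multiplied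
  by \<open>2 \<alpha>\<close>, are exactly \<open>Q / B - \<parallel>r\<parallel>\<^sup>2\<close>, and \<open>Q / B \<le> Q\<close>.\<close>

lemma relative_error_residual:
  fixes w r :: "'a::real_inner"
  assumes "\<alpha> > 0" and "L \<ge> 0"
    and crit: "(norm (\<alpha> *\<^sub>R (w + L *\<^sub>R r) + r))\<^sup>2 + 2 * \<alpha> * e \<le> \<sigma>\<^sup>2 * (norm r)\<^sup>2"
  shows "w \<bullet> r + e + L / 2 * (norm r)\<^sup>2 + \<alpha> / (1 + \<alpha> * L) / 2 * (norm w)\<^sup>2
           \<le> - ((1 - \<sigma>\<^sup>2) / (2 * \<alpha>) * (norm r)\<^sup>2)"
proof -
  define B where "B = 1 + \<alpha> * L"
  define Q where "Q = (norm (\<alpha> *\<^sub>R w + B *\<^sub>R r))\<^sup>2"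
  have B: "B \<ge> 1"
    using assms by (simp add: B_def)
  have Q: "Q = \<alpha>\<^sup>2 * (norm w)\<^sup>2 + 2 * \<alpha> * B * (w \<bullet> r) + B\<^sup>2 * (norm r)\<^sup>2"
    unfolding Q_def power2_norm_eq_inner
    by (simp add: inner_add_left inner_add_right inner_commute[of r w] power2_eq_square algebra_simps)
  have "Q / B \<le> Q"
    using B by (simp add: Q_def divide_le_eq mult_le_cancel_left1)
  moreover have "\<alpha> *\<^sub>R (w + L *\<^sub>R r) + r = \<alpha> *\<^sub>R w + B *\<^sub>R r"
    by (simp add: B_def algebra_simps)
  then have "2 * \<alpha> * e \<le> \<sigma>\<^sup>2 * (norm r)\<^sup>2 - Q"
    using crit by (simp add: Q_def)
  moreover have "2 * \<alpha> * (w \<bullet> r + L / 2 * (norm r)\<^sup>2 + \<alpha> / B / 2 * (norm w)\<^sup>2) = Q / B - (norm r)\<^sup>2"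
  proof -
    have "Q / B = \<alpha>\<^sup>2 * (norm w)\<^sup>2 / B + 2 * \<alpha> * (w \<bullet> r) + B * (norm r)\<^sup>2"
      using B by (simp add: Q power2_eq_square field_simps)
    moreover have "2 * \<alpha> * (w \<bullet> r + L / 2 * (norm r)\<^sup>2 + \<alpha> / B / 2 * (norm w)\<^sup>2)
        = 2 * \<alpha> * (w \<bullet> r) + (\<alpha> * L) * (norm r)\<^sup>2 + \<alpha>\<^sup>2 * (norm w)\<^sup>2 / B"
      by (simp add: power2_eq_square algebra_simps)
    moreover have "\<alpha> * L = B - 1"
      by (simp add: B_def)
    ultimately show ?thesis
      by (simp add: left_diff_distrib)
  qed
  ultimately have "2 * \<alpha> * (w \<bullet> r + e + L / 2 * (norm r)\<^sup>2 + \<alpha> / B / 2 * (norm w)\<^sup>2)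
      \<le> - (1 - \<sigma>\<^sup>2) * (norm r)\<^sup>2"
    by (simp add: algebra_simps)
  then have "w \<bullet> r + e + L / 2 * (norm r)\<^sup>2 + \<alpha> / B / 2 * (norm w)\<^sup>2
      \<le> (- (1 - \<sigma>\<^sup>2) * (norm r)\<^sup>2) / (2 * \<alpha>)"
    using \<open>\<alpha> > 0\<close> by (subst pos_le_divide_eq) (simp_all add: mult.commute)
  also have "\<dots> = - ((1 - \<sigma>\<^sup>2) / (2 * \<alpha>) * (norm r)\<^sup>2)"
    by (metis minus_divide_left minus_mult_left times_divide_eq_left)
  finally show ?thesis
    unfolding B_def .
qed

text \<open>The abstract step: \<open>\<Phi>\<close> and \<open>\<Phi>'\<close> stand for the objective gaps at the old and the new point,
  \<open>\<eta>\<close> for the loss in the affine minorant and \<open>\<delta>\<close> for the guaranteed gain. The minorant is evaluated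
  at the old point \<open>p\<close> and at the minimizer \<open>s\<close>, where the gap is \<open>0\<close>. The bound at \<open>p\<close> keeps
  its weight \<open>t\<close> because at the first step \<open>t = 0\<close> and the objective may be infinite at \<open>p\<close>.\<close>

lemma accelerated_step_decrease:
  fixes p p' q s c w :: "'a::real_inner"
  assumes "0 \<le> t" and "0 \<le> a" and "t + a > 0" and step: "a\<^sup>2 = lam * (t + a)"
    and q: "q = (t / (t + a)) *\<^sub>R p + (a / (t + a)) *\<^sub>R c"
    and old: "t * \<Phi> \<ge> t * (\<Phi>' + w \<bullet> (p - p') - \<eta>)"
    and opt: "0 \<ge> \<Phi>' + w \<bullet> (s - p') - \<eta>"
    and gain: "w \<bullet> (p' - q) + \<eta> + lam / 2 * (norm w)\<^sup>2 \<le> - \<delta>"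
  shows "1 / 2 * (norm (c - a *\<^sub>R w - s))\<^sup>2 + (t + a) * \<Phi>' + (t + a) * \<delta>
           \<le> 1 / 2 * (norm (c - s))\<^sup>2 + t * \<Phi>"
proof -
  have "(t + a) *\<^sub>R q = t *\<^sub>R p + a *\<^sub>R c"
    using \<open>t + a > 0\<close> by (simp add: q scaleR_add_right)
  then have "w \<bullet> ((t + a) *\<^sub>R q) = w \<bullet> (t *\<^sub>R p + a *\<^sub>R c)"
    by (rule arg_cong)
  then have avg: "(t + a) * (w \<bullet> q) = t * (w \<bullet> p) + a * (w \<bullet> c)"
    by (simp add: inner_add_right)
  have "(norm (c - a *\<^sub>R w - s))\<^sup>2 = (norm (c - s))\<^sup>2 - 2 * a * (w \<bullet> (c - s)) + a\<^sup>2 * (norm w)\<^sup>2"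
    unfolding power2_norm_eq_inner
    by (simp add: inner_diff_left inner_diff_right inner_commute power2_eq_square algebra_simps)
  then have expand: "1 / 2 * (norm (c - a *\<^sub>R w - s))\<^sup>2
      = 1 / 2 * (norm (c - s))\<^sup>2 - a * (w \<bullet> c) + a * (w \<bullet> s) + (t + a) * (lam / 2 * (norm w)\<^sup>2)"
    by (simp only: step) (simp add: inner_diff_right field_simps)
  have "(t + a) * (w \<bullet> (p' - q) + \<eta> + lam / 2 * (norm w)\<^sup>2) \<le> (t + a) * (- \<delta>)"
    using gain \<open>t + a > 0\<close> by (intro mult_left_mono) auto
  moreover have "a * (\<Phi>' + w \<bullet> (s - p') - \<eta>) \<le> 0"
    using opt \<open>0 \<le> a\<close> by (simp add: mult_nonneg_nonpos)
  ultimately show ?thesis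
    using old avg unfolding expand by (simp add: inner_diff_right algebra_simps)
qed

section \<open>The step size sequence\<close>

text \<open>The increment of the sequence is the positive root of \<open>a\<^sup>2 = lam * (t + a)\<close>, the balance that
  lets the quadratic term of an accelerated step be absorbed.\<close>

lemma step_size_square:
  fixes lam t :: real
  assumes "lam > 0" and "t \<ge> 0"
  defines "a \<equiv> (lam + sqrt (lam\<^sup>2 + 4 * lam * t)) / 2"
  shows "a\<^sup>2 = lam * (t + a)" and "a > 0"
proof -
  have "2 * a - lam = sqrt (lam\<^sup>2 + 4 * lam * t)"
    by (simp add: a_def field_simps)
  then have "(2 * a - lam)\<^sup>2 = lam\<^sup>2 + 4 * lam * t"
    using assms(1,2) by simp
  then show "a\<^sup>2 = lam * (t + a)"
    by (simp add: power2_eq_square algebra_simps)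
  show "a > 0"
    using assms(1,2) unfolding a_def by (intro divide_pos_pos add_pos_nonneg) auto
qed

text \<open>Inductively the square root is at least \<open>lam * k\<close>, so the increment is at least
  \<open>lam * (k + 1) / 2\<close>, more than \<open>lam * (2 * k + 1) / 4\<close>, the increment of the quadratic.\<close>

lemma step_size_quadratic_growth:
  fixes lam :: real
  assumes "lam > 0" and "\<tau> 0 = 0"
    and rec: "\<And>k. \<tau> (Suc k) = \<tau> k + (lam + sqrt (lam\<^sup>2 + 4 * lam * \<tau> k)) / 2"
  shows "\<tau> k \<ge> lam * (real k)\<^sup>2 / 4"
proof (induction k)
  case 0
  then show ?case using assms(2) by simp
next
  case (Suc k)
  define s where "s = sqrt (lam\<^sup>2 + 4 * lam * \<tau> k)"
  have "lam * (lam * (real k)\<^sup>2) \<le> lam * (4 * \<tau> k)"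
    using Suc \<open>lam > 0\<close> by (intro mult_left_mono) auto
  then have "(lam * real k)\<^sup>2 \<le> lam\<^sup>2 + 4 * lam * \<tau> k"
    using zero_le_power2[of lam] unfolding power_mult_distrib power2_eq_square by (simp add: ac_simps add_increasing)
  then have "lam * real k \<le> s"
    unfolding s_def by (rule real_le_rsqrt)
  have "lam * (real (Suc k))\<^sup>2 / 4 = lam * (real k)\<^sup>2 / 4 + lam * real k / 2 + lam / 4"
    by (simp add: power2_eq_square field_simps)
  also have "\<dots> \<le> \<tau> k + (lam + s) / 2"
    using Suc \<open>lam > 0\<close> \<open>lam * real k \<le> s\<close> by argo
  finally show ?case
    unfolding rec[of k] s_def .
qed

section \<open>Convergence of the method\<close>

theorem theorem5p4:
  fixes f :: "'a::{real_inner, heine_borel} \<Rightarrow> real"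
    and gradf :: "'a \<Rightarrow> 'a"
    and g F :: "'a \<Rightarrow> ereal"
    and L \<alpha> \<sigma> Fstar d0 :: real
    and x0 xstar :: 'a
    and x xt y v :: "nat \<Rightarrow> 'a"
    and \<tau> \<epsilon> :: "nat \<Rightarrow> real"
  assumes f_convex: "convex_on UNIV f"
    and f_gradient: "\<And>z. GDERIV f z :> gradf z"
    and L_pos: "L > 0"
    and gradient_lipschitz: "L-lipschitz_on UNIV gradf"
    and g_proper: "proper_fun g"
    and g_lsc: "lower_semicontinuous g"
    and g_convex: "ereal_convex g"
    and F_eq: "F = (\<lambda>z. ereal (f z) + g z)"
    and Fstar_eq: "ereal Fstar = (INF z. F z)"
    and minimizers_nonempty: "minimizers F \<noteq> {}"
    and alpha: "\<alpha> > 1 / L"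
    and sigma: "\<sigma> \<in> {0..1}"
    and run: "ie_fista gradf g L \<alpha> \<sigma> x0 x xt \<tau> y v \<epsilon>"
    and d0_eq: "d0 = infdist x0 (minimizers F)"
    and xstar_eq: "xstar = closest_point (minimizers F) x0"
  shows "(\<forall>k\<ge>1.
            ereal (1 / 2 * (norm (x k - xstar))\<^sup>2)
            + ereal (\<tau> k) * (F (xt k) - ereal Fstar)
            + ereal ((1 - \<sigma>\<^sup>2) / (2 * \<alpha>) * (\<Sum>i = 1..k. \<tau> i * (norm (xt i - y (i - 1)))\<^sup>2))
            \<le> ereal (1 / 2 * d0\<^sup>2))
       \<and> (\<forall>k\<ge>1.
            F (xt k) - ereal Fstar
            \<le> ereal (2 * (1 + \<alpha> * L) / (\<alpha> * (real k)\<^sup>2) * d0\<^sup>2))"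
proof -
  define lam where "lam = \<alpha> / (1 + \<alpha> * L)"
  have "\<alpha> > 0"
    using alpha L_pos by (meson less_trans zero_less_divide_1_iff)
  then have "lam > 0" and "1 + \<alpha> * L > 0"
    using L_pos by (simp_all add: lam_def add_pos_pos)
  have x_0: "x 0 = x0" and \<tau>_0: "\<tau> 0 = 0"
    and \<tau>_Suc: "\<And>k. \<tau> (Suc k) = \<tau> k + (lam + sqrt (lam\<^sup>2 + 4 * lam * \<tau> k)) / 2"
    and y_eq: "\<And>k. y k = (\<tau> k / \<tau> (Suc k)) *\<^sub>R xt k + ((\<tau> (Suc k) - \<tau> k) / \<tau> (Suc k)) *\<^sub>R x k"
    and v_in: "\<And>k. v (Suc k) \<in> (\<lambda>u. u + L *\<^sub>R (xt (Suc k) - y k) + gradf (y k)) `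
                        eps_subdiff (\<epsilon> (Suc k)) g (xt (Suc k))"
    and crit: "\<And>k. (norm (\<alpha> *\<^sub>R v (Suc k) + xt (Suc k) - y k))\<^sup>2 + 2 * \<alpha> * \<epsilon> (Suc k)
                  \<le> \<sigma>\<^sup>2 * (norm (xt (Suc k) - y k))\<^sup>2"
    and x_Suc: "\<And>k. x (Suc k) = x k - (\<tau> (Suc k) - \<tau> k) *\<^sub>R (v (Suc k) + L *\<^sub>R (y k - xt (Suc k)))"
    using run unfolding ie_fista_def Let_def lam_def[symmetric] by blast+
  have \<tau>_growth: "\<tau> k \<ge> lam * (real k)\<^sup>2 / 4" for k
    using \<open>lam > 0\<close> \<tau>_0 \<tau>_Suc by (rule step_size_quadratic_growth)
  have \<tau>_pos: "\<tau> k > 0" if "k \<ge> 1" for k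
    using \<open>lam > 0\<close> that by (intro less_le_trans[OF _ \<tau>_growth[of k]]) simp
  have \<tau>_nonneg: "\<tau> k \<ge> 0" for k
    using \<tau>_pos[of k] \<tau>_0 by (cases k) auto

  have "continuous_on UNIV f"
    using f_gradient unfolding gderiv_def
    by (meson has_derivative_at_withinI has_derivative_continuous_on)
  then have closed: "closed (minimizers F)"
    unfolding F_eq using g_lsc g_proper
    by (intro closed_minimizers_add_lower_semicontinuous) (auto simp: proper_fun_def)
  have "norm (x0 - xstar) = d0"
    using dist_closest_point_eq_infdist[OF closed minimizers_nonempty]
    by (simp add: d0_eq xstar_eq dist_norm)
  have "xstar \<in> minimizers F"
    unfolding xstar_eq by (rule closest_point_in_set[OF closed minimizers_nonempty])
  then have "F xstar = ereal Fstar"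
    unfolding Fstar_eq minimizers_def by (intro antisym INF_greatest INF_lower) auto
  then have g_xstar: "g xstar = ereal (Fstar - f xstar)"
    unfolding F_eq by (cases "g xstar") auto

  \<comment> \<open>The junk value that \<open>real_of_ereal\<close> takes at \<open>\<infinity>\<close> can occur only for \<open>k = 0\<close>, where the weight
    \<open>\<tau> 0 = 0\<close> hides it.\<close>
  define \<Phi> where "\<Phi> k = f (xt k) + real_of_ereal (g (xt k)) - Fstar" for k
  have g_xt: "g (xt k) = ereal (real_of_ereal (g (xt k)))" if k: "k \<ge> 1" for k
  proof -
    obtain j where "k = Suc j"
      using k by (cases k) auto
    then have "g (xt k) < \<infinity>"
      using v_in[of j] by (auto simp: eps_subdiff_def)
    moreover have "g (xt k) \<noteq> -\<infinity>"
      using g_proper by (simp add: proper_fun_def)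
    ultimately show ?thesis
      by (cases "g (xt k)") auto
  qed
  have F_xt: "F (xt k) - ereal Fstar = ereal (\<Phi> k)" if "k \<ge> 1" for k
    unfolding F_eq \<Phi>_def by (subst g_xt[OF that]) simp

  have step: "1 / 2 * (norm (x (Suc k) - xstar))\<^sup>2 + \<tau> (Suc k) * \<Phi> (Suc k)
        + \<tau> (Suc k) * ((1 - \<sigma>\<^sup>2) / (2 * \<alpha>) * (norm (xt (Suc k) - y k))\<^sup>2)
      \<le> 1 / 2 * (norm (x k - xstar))\<^sup>2 + \<tau> k * \<Phi> k" for k
  proof -
    define a where "a = (lam + sqrt (lam\<^sup>2 + 4 * lam * \<tau> k)) / 2"
    have \<tau>_next: "\<tau> (Suc k) = \<tau> k + a"
      unfolding a_def by (rule \<tau>_Suc)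
    have a: "a\<^sup>2 = lam * (\<tau> k + a)" "a > 0"
      unfolding a_def by (rule step_size_square[OF \<open>lam > 0\<close> \<tau>_nonneg])+
    obtain u where u: "u \<in> eps_subdiff (\<epsilon> (Suc k)) g (xt (Suc k))"
      and v: "v (Suc k) = u + L *\<^sub>R (xt (Suc k) - y k) + gradf (y k)"
      using v_in[of k] by blast
    define w where "w = u + gradf (y k)"
    define r where "r = xt (Suc k) - y k"
    define \<eta> where "\<eta> = \<epsilon> (Suc k) + L / 2 * (norm r)\<^sup>2"
    have minorant: "f z + gz - Fstar \<ge> \<Phi> (Suc k) + w \<bullet> (z - xt (Suc k)) - \<eta>"
      if "g z = ereal gz" for z gz
      using composite_lower_bound[OF f_convex f_gradient gradient_lipschitz u g_xt that, of "y k"]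
      by (simp add: \<Phi>_def w_def r_def \<eta>_def)
    have "\<alpha> *\<^sub>R v (Suc k) + xt (Suc k) - y k = \<alpha> *\<^sub>R (w + L *\<^sub>R r) + r"
      by (simp add: v w_def r_def algebra_simps)
    then have "w \<bullet> r + \<epsilon> (Suc k) + L / 2 * (norm r)\<^sup>2 + lam / 2 * (norm w)\<^sup>2
        \<le> - ((1 - \<sigma>\<^sup>2) / (2 * \<alpha>) * (norm r)\<^sup>2)"
      unfolding lam_def using \<open>\<alpha> > 0\<close> L_pos crit[of k]
      by (intro relative_error_residual) (auto simp: r_def add_diff_eq)
    then have gain: "w \<bullet> (xt (Suc k) - y k) + \<eta> + lam / 2 * (norm w)\<^sup>2
        \<le> - ((1 - \<sigma>\<^sup>2) / (2 * \<alpha>) * (norm r)\<^sup>2)"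
      by (simp add: \<eta>_def r_def)
    have old: "\<tau> k * \<Phi> k \<ge> \<tau> k * (\<Phi> (Suc k) + w \<bullet> (xt k - xt (Suc k)) - \<eta>)"
    proof (cases "k = 0")
      case False
      then have "\<Phi> k \<ge> \<Phi> (Suc k) + w \<bullet> (xt k - xt (Suc k)) - \<eta>"
        using minorant[OF g_xt, of k] by (simp add: \<Phi>_def[of k])
      then show ?thesis
        using \<tau>_nonneg by (rule mult_left_mono)
    qed (simp add: \<tau>_0)
    have opt: "0 \<ge> \<Phi> (Suc k) + w \<bullet> (xstar - xt (Suc k)) - \<eta>"
      using minorant[OF g_xstar] by simp
    have x_next: "x (Suc k) = x k - a *\<^sub>R w"
      using x_Suc[of k] by (simp add: \<tau>_next v w_def algebra_simps)
    have "y k = (\<tau> k / (\<tau> k + a)) *\<^sub>R xt k + (a / (\<tau> k + a)) *\<^sub>R x k"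
      using y_eq[of k] by (simp add: \<tau>_next)
    then show ?thesis
      unfolding x_next \<tau>_next r_def[symmetric]
      using \<tau>_nonneg[of k] a old opt gain
      by (intro accelerated_step_decrease) auto
  qed

  have potential: "1 / 2 * (norm (x k - xstar))\<^sup>2 + \<tau> k * \<Phi> k
      + (1 - \<sigma>\<^sup>2) / (2 * \<alpha>) * (\<Sum>i = 1..k. \<tau> i * (norm (xt i - y (i - 1)))\<^sup>2) \<le> 1 / 2 * d0\<^sup>2" for k
  proof (induction k)
    case 0
    then show ?case
      by (simp add: x_0 \<tau>_0 \<open>norm (x0 - xstar) = d0\<close>)
  next
    case (Suc k)
    then show ?case
      using step[of k] by (simp add: distrib_left mult.left_commute)
  qed

  have rate: "\<Phi> k \<le> 2 * (1 + \<alpha> * L) / (\<alpha> * (real k)\<^sup>2) * d0\<^sup>2" if "k \<ge> 1" for k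
  proof -
    have "\<sigma>\<^sup>2 \<le> 1"
      using sigma by (simp add: power_le_one)
    then have "0 \<le> (1 - \<sigma>\<^sup>2) / (2 * \<alpha>) * (\<Sum>i = 1..k. \<tau> i * (norm (xt i - y (i - 1)))\<^sup>2)"
      using \<open>\<alpha> > 0\<close> \<tau>_nonneg by (intro mult_nonneg_nonneg sum_nonneg) auto
    moreover have "0 \<le> (norm (x k - xstar))\<^sup>2"
      by simp
    ultimately have "\<tau> k * \<Phi> k \<le> 1 / 2 * d0\<^sup>2"
      using potential[of k] by linarith
    then have "\<Phi> k \<le> (1 / 2 * d0\<^sup>2) / \<tau> k"
      using \<tau>_pos[OF that] by (simp add: pos_le_divide_eq mult.commute)
    also have "\<dots> \<le> (1 / 2 * d0\<^sup>2) / (lam * (real k)\<^sup>2 / 4)"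
      using \<tau>_growth[of k] \<open>lam > 0\<close> that by (intro divide_left_mono mult_pos_pos \<tau>_pos) auto
    also have "\<dots> = 2 * (1 + \<alpha> * L) / (\<alpha> * (real k)\<^sup>2) * d0\<^sup>2"
      using \<open>\<alpha> > 0\<close> \<open>1 + \<alpha> * L > 0\<close> that by (simp add: lam_def field_simps)
    finally show ?thesis .
  qed

  show ?thesis
    using potential rate by (auto simp: F_xt)
qed

end
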